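(* Let $n_1,n_2$ be positive integers and $n=\min\{n_1,n_2\}$. Let $0\le\alpha<1$ and $0<\mu\le1$ be real, let $f\in\mathcal{A}_{n_1}$ and $g\in\mathcal{A}_{n_2}\cap\mathcal{S}^{*}(\alpha)$. Let $\beta\ge0$, $\gamma\ge0$ be real with $\beta+\gamma>0$, and let $\delta\in\mathbb{C}$ satisfy $\mathrm{Re}(\delta)>-\frac{\mu n}{2}-\alpha$. Suppose that $$ \left|\left(\frac{zf'(z)}{g(z)}\right)^{\frac1\mu}-1\right|^{\beta}\left(\mathrm{Re}\left(\delta+1+\frac{zf''(z)}{f'(z)}\right)\right)^{\gamma}\le\left(\mathrm{Re}(\delta)+\alpha+\frac{\mu n}{2}\right)^{\gamma}\qquad\text{for all } z\in\mathbb{U}. $$ Then $$ \left|\left(\frac{zf'(z)}{g(z)}\right)^{\frac1\mu}-1\right|<1\qquad\text{for all } z\in\mathbb{U}, $$ and consequently $f\in\mathcal{STC}(\mu)$.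
   Context: $\mathbb{U}=\{z\in\mathbb{C}:|z|<1\}$ is the open unit disk. For a positive integer $m$, $\mathcal{A}_m$ is the class of functions analytic in $\mathbb{U}$ of the form $f(z)=z+a_{m+1}z^{m+1}+a_{m+2}z^{m+2}+\cdots$; $\mathcal{A}=\mathcal{A}_1$ (which contains every $\mathcal{A}_m$). For $0\le\alpha<1$, $\mathcal{S}^{*}(\alpha)$ is the class of functions $g\in\mathcal{A}$ with $\mathrm{Re}\left(\frac{zg'(z)}{g(z)}\right)>\alpha$ for all $z\in\mathbb{U}$ (starlike of order $\alpha$), and $\mathcal{S}^{*}=\mathcal{S}^{*}(0)$. Quotients such as $zg'(z)/g(z)$ and $zf'(z)/g(z)$ are given their limiting value $1$ at $z=0$; $g$ has no zero in $\mathbb{U}\setminus\{0\}$. For $0<\mu\le1$, $\mathcal{STC}(\mu)$ (strongly close-to-convex functions of order $\mu$) is the class of $f\in\mathcal{A}$ for which there exists $g\in\mathcal{S}^{*}$ with $\mathrm{Re}\left(\left(\frac{zf'(z)}{g(z)}\right)^{1/\mu}\right)>0$ for all $z\in\mathbb{U}$. Conventions: the expressions in the hypothesis are understood to be well defined, so $f'(z)\ne0$ in $\mathbb{U}$. The power $(zf'(z)/g(z))^{1/\mu}$ is the analytic branch in $\mathbb{U}$ with value $1$ at $z=0$. Real powers have their usual meaning, with $x^0=1$ for all real $x$ (including $x=0$); when $\gamma$ is not a nonnegative integer, the hypothesis is understood to require that the real part raised to the power $\gamma$ be nonnegative. *)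

theory Defs
  imports "HOL-Complex_Analysis.Complex_Analysis"
begin

abbreviation unit_disk :: "complex set" where
  "unit_disk \<equiv> ball 0 1"

definition class_A :: "nat \<Rightarrow> (complex \<Rightarrow> complex) set" where
  "class_A m = {f. f holomorphic_on unit_disk \<and>
     (\<exists>a :: nat \<Rightarrow> complex. \<forall>z\<in>unit_disk. (\<lambda>k. a k * z ^ (m + 1 + k)) sums (f z - z))}"

text \<open>The quotient \<open>z f'(z) / g(z)\<close> for \<open>f, g\<close> in \<open>class_A 1\<close>; at the origin it has a removable
  singularity with limiting value \<open>1\<close>.\<close>

definition zderiv_quot :: "(complex \<Rightarrow> complex) \<Rightarrow> (complex \<Rightarrow> complex) \<Rightarrow> complex \<Rightarrow> complex" where
  "zderiv_quot f g z = (if z = 0 then 1 else z * deriv f z / g z)"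

definition starlike_of_order :: "real \<Rightarrow> (complex \<Rightarrow> complex) set" where
  "starlike_of_order \<alpha> = {g \<in> class_A 1.
     (\<forall>z\<in>unit_disk - {0}. g z \<noteq> 0) \<and>
     (\<forall>z\<in>unit_disk. Re (zderiv_quot g g z) > \<alpha>)}"

definition log_branch :: "(complex \<Rightarrow> complex) \<Rightarrow> (complex \<Rightarrow> complex) \<Rightarrow> bool" where
  "log_branch h L \<longleftrightarrow>
     L holomorphic_on unit_disk \<and> L 0 = 0 \<and> (\<forall>z\<in>unit_disk. exp (L z) = h z)"

text \<open>The analytic branch of \<open>h(z)\<^sup>c\<close> on the unit disk with value \<open>1\<close> at the origin. It is meaningful
  when \<open>h\<close> is holomorphic without zeros on the disk and \<open>h 0 = 1\<close>, and it need not agree with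
  \<open>powr\<close>, which uses the principal logarithm. The lemmas \<open>branch_power_eq\<close> and
  \<open>log_branch_exists\<close> show that it is then well defined.\<close>

definition branch_power :: "(complex \<Rightarrow> complex) \<Rightarrow> real \<Rightarrow> complex \<Rightarrow> complex" where
  "branch_power h c z = (THE w. \<exists>L. log_branch h L \<and> w = exp (of_real c * L z))"

lemma log_branch_unique:
  assumes "log_branch h L" "log_branch h M" "z \<in> unit_disk"
  shows "L z = M z"
proof -
  define D where "D = (\<lambda>z. L z - M z)"
  have hol: "L holomorphic_on unit_disk" "M holomorphic_on unit_disk"
    using assms by (auto simp: log_branch_def)
  have *: "\<exists>c. (deriv D w = c) \<and> c = 0" if "w \<in> unit_disk" for w
  proof -
    have dL: "(L has_field_derivative deriv L w) (at w)"
      and dM: "(M has_field_derivative deriv M w) (at w)"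
      using hol that by (auto intro: holomorphic_derivI)
    have "((\<lambda>z. exp (L z)) has_field_derivative exp (L w) * deriv L w) (at w)"
      using dL by (auto intro!: derivative_eq_intros)
    moreover have "((\<lambda>z. exp (M z)) has_field_derivative exp (M w) * deriv M w) (at w)"
      using dM by (auto intro!: derivative_eq_intros)
    then have "((\<lambda>z. exp (L z)) has_field_derivative exp (M w) * deriv M w) (at w)"
      by (rule has_field_derivative_transform_within_open[OF _ open_ball that])
         (use assms in \<open>auto simp: log_branch_def\<close>)
    ultimately have "exp (L w) * deriv L w = exp (M w) * deriv M w"
      by (rule DERIV_unique)
    moreover have "exp (L w) = exp (M w)"
      using assms that by (auto simp: log_branch_def)
    ultimately have "deriv L w = deriv M w" by simp
    moreover have "(D has_field_derivative deriv L w - deriv M w) (at w)"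
      unfolding D_def by (intro derivative_intros dL dM)
    ultimately show ?thesis by (auto intro: DERIV_imp_deriv)
  qed
  have "D holomorphic_on unit_disk"
    unfolding D_def by (intro holomorphic_intros hol)
  then have "D constant_on unit_disk"
    by (intro has_field_derivative_0_imp_constant_on)
       (use * holomorphic_derivI[of D unit_disk] in fastforce)+
  then have "D z = D 0"
    using assms(3) by (auto simp: constant_on_def)
  then show ?thesis
    using assms by (simp add: D_def log_branch_def)
qed

lemma branch_power_eq:
  assumes "log_branch h L" "z \<in> unit_disk"
  shows "branch_power h c z = exp (of_real c * L z)"
  unfolding branch_power_def
proof (rule the_equality)
  show "\<exists>M. log_branch h M \<and> exp (of_real c * L z) = exp (of_real c * M z)"
    using assms(1) by blast
next
  fix w assume "\<exists>M. log_branch h M \<and> w = exp (of_real c * M z)"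
  then show "w = exp (of_real c * L z)"
    using log_branch_unique[OF assms(1) _ assms(2)] by auto
qed

lemma log_branch_exists:
  assumes "h holomorphic_on unit_disk" "\<And>z. z \<in> unit_disk \<Longrightarrow> h z \<noteq> 0" "h 0 = 1"
  shows "\<exists>L. log_branch h L"
proof -
  have "\<exists>M. M holomorphic_on unit_disk \<and> (\<forall>z\<in>unit_disk. h z = exp (M z))"
    using contractible_imp_holomorphic_log[OF assms(1) convex_imp_contractible[OF convex_ball]]
      assms(2) by metis
  then obtain M where M: "M holomorphic_on unit_disk" "\<And>z. z \<in> unit_disk \<Longrightarrow> h z = exp (M z)"
    by blast
  have "log_branch h (\<lambda>z. M z - M 0)"
    unfolding log_branch_def
    using M M(2)[of 0] assms(3) by (auto intro!: holomorphic_intros simp: exp_diff)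
  then show ?thesis by blast
qed

text \<open>The function \<open>powr\<close> alone would give \<open>0 powr 0 = 0\<close> and is not the usual power of a negative base
  with an integer exponent. For an exponent outside \<open>\<nat>\<close> this is meaningful only for \<open>x \<ge> 0\<close>.\<close>

definition real_power :: "real \<Rightarrow> real \<Rightarrow> real" where
  "real_power x a = (if a \<in> \<nat> then x ^ nat \<lfloor>a\<rfloor> else x powr a)"

text \<open>The branch of the power exists only if \<open>f'\<close> has no zero in the disk, hence the
  explicit condition.\<close>

definition strongly_close_to_convex :: "real \<Rightarrow> (complex \<Rightarrow> complex) set" where
  "strongly_close_to_convex \<mu> = {f \<in> class_A 1.
     (\<forall>z\<in>unit_disk. deriv f z \<noteq> 0) \<and>
     (\<exists>g \<in> starlike_of_order 0.
        \<forall>z\<in>unit_disk. Re (branch_power (zderiv_quot f g) (1 / \<mu>) z) > 0)}"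

end

theory Submission
  imports Defs
begin

text \<open>Put \<open>w = (z f' / g)\<^sup>1\<^sup>/\<^sup>\<mu> - 1 = z\<^sup>n \<phi>(z)\<close>. If \<open>|w|\<close> reaches 1, then at a point \<open>z0\<close> of smallest
  modulus with \<open>|w(z0)| = 1\<close> Jack's lemma gives \<open>z0 w'(z0) = k w(z0)\<close> with a real \<open>k \<ge> n\<close>.
  Logarithmic differentiation yields \<open>1 + z f''/f' = z g'/g + \<mu> z w'/(1 + w)\<close>, and
  \<open>Re (w/(1 + w)) = 1/2\<close> on the unit circle, so the real part of the left-hand side at \<open>z0\<close>
  exceeds \<open>\<alpha> + \<mu> n/2\<close>, against the hypothesis when \<open>\<gamma> > 0\<close>. When \<open>\<gamma> = 0\<close> the hypothesis says
  \<open>|w| \<le> 1\<close>, and the maximum modulus principle applies.\<close>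

section \<open>Power series form of the classes and of the quotient\<close>

lemma class_A_factor:
  assumes "f \<in> class_A m"
  obtains F where "F holomorphic_on unit_disk"
    and "\<And>z. z \<in> unit_disk \<Longrightarrow> f z = z + z ^ (m + 1) * F z"
proof -
  obtain a :: "nat \<Rightarrow> complex"
    where a: "\<And>z. z \<in> unit_disk \<Longrightarrow> (\<lambda>k. a k * z ^ (m + 1 + k)) sums (f z - z)"
    using assms unfolding class_A_def by blast
  \<comment> \<open>For z \<noteq> 0 the factor \<open>z ^ (m + 1)\<close> can be cancelled from the
    given series, so the shifted series converges on the whole disk and has radius of convergence at
    least 1.\<close>
  have s: "summable (\<lambda>k. a k * z ^ k)" if "z \<in> unit_disk" for z
  proof (cases "z = 0")
    case False
    have "summable (\<lambda>k. z ^ (m + 1) * (a k * z ^ k))"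
      using sums_summable[OF a[OF that]] by (simp add: power_add mult_ac)
    then show ?thesis
      using False by (simp only: summable_cmult_iff) auto
  qed auto
  define F where "F z = (\<Sum>k. a k * z ^ k)" for z
  have "F holomorphic_on unit_disk"
    by (rule power_series_holomorphic[of 0 1 a]) (use s in \<open>auto simp: F_def summable_sums\<close>)
  moreover have "f z = z + z ^ (m + 1) * F z" if "z \<in> unit_disk" for z
  proof -
    have "(\<lambda>k. z ^ (m + 1) * (a k * z ^ k)) sums (z ^ (m + 1) * F z)"
      unfolding F_def by (intro sums_mult summable_sums s that)
    then have "(\<lambda>k. a k * z ^ (m + 1 + k)) sums (z ^ (m + 1) * F z)"
      by (simp add: power_add mult_ac)
    from sums_unique2[OF this a[OF that]] show ?thesis
      by (simp add: algebra_simps)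
  qed
  ultimately show ?thesis using that by blast
qed

lemma class_A_mono:
  assumes "f \<in> class_A m" "k \<le> m"
  shows "f \<in> class_A k"
proof -
  obtain a :: "nat \<Rightarrow> complex" where f: "f holomorphic_on unit_disk"
    and a: "\<And>z. z \<in> unit_disk \<Longrightarrow> (\<lambda>j. a j * z ^ (m + 1 + j)) sums (f z - z)"
    using assms unfolding class_A_def by blast
  \<comment> \<open>The coefficients are padded in front with m - k zeros.\<close>
  define b where "b j = (if j < m - k then 0 else a (j - (m - k)))" for j
  have "(\<lambda>j. b j * z ^ (k + 1 + j)) sums (f z - z)" if "z \<in> unit_disk" for z
  proof -
    have "(\<lambda>j. b (j + (m - k)) * z ^ (k + 1 + (j + (m - k)))) sums (f z - z)"
    proof -
      have "b (j + (m - k)) = a j" "k + 1 + (j + (m - k)) = m + 1 + j" for j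
        using assms(2) by (simp_all add: b_def)
      then show ?thesis using a[OF that] by (simp only:)
    qed
    then show ?thesis
      by (subst (asm) sums_zero_iff_shift) (simp_all add: b_def)
  qed
  then show ?thesis
    unfolding class_A_def using f by (intro CollectI conjI exI[of _ b] ballI)
qed

lemma class_A_deriv_factor:
  assumes "f \<in> class_A m"
  obtains F where "F holomorphic_on unit_disk"
    and "\<And>z. z \<in> unit_disk \<Longrightarrow> deriv f z = 1 + z ^ m * F z"
proof -
  obtain F where F: "F holomorphic_on unit_disk"
    and fF: "\<And>z. z \<in> unit_disk \<Longrightarrow> f z = z + z ^ (m + 1) * F z"
    using class_A_factor[OF assms] by blast
  define G where "G z = of_nat (m + 1) * F z + z * deriv F z" for z
  have "G holomorphic_on unit_disk"
    unfolding G_def by (intro holomorphic_intros F open_ball)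
  moreover have "deriv f z = 1 + z ^ m * G z" if z: "z \<in> unit_disk" for z
  proof -
    have "((\<lambda>z. z + z ^ (m + 1) * F z) has_field_derivative 1 + z ^ m * G z) (at z)"
      unfolding G_def
      by (rule derivative_eq_intros holomorphic_derivI[OF F open_ball z] refl)+
         (simp add: algebra_simps)
    then have "(f has_field_derivative 1 + z ^ m * G z) (at z)"
      by (rule has_field_derivative_transform_within_open[OF _ open_ball z]) (simp add: fF)
    then show ?thesis by (rule DERIV_imp_deriv)
  qed
  ultimately show ?thesis using that by blast
qed

text \<open>After cancelling z, both f' and g/z have the form 1 + O(z^n), hence so does their
  quotient. The exponent n = min(n1, n2) enters here and later becomes the lower bound for k in
  Jack's lemma.\<close>

lemma zderiv_quot_factor:
  assumes f: "f \<in> class_A n1" and g: "g \<in> class_A n2"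
    and "n \<le> n1" "n \<le> n2" "0 < n"
    and nz: "\<And>z. z \<in> unit_disk - {0} \<Longrightarrow> g z \<noteq> 0"
  obtains \<psi> where "\<psi> holomorphic_on unit_disk"
    and "\<And>z. z \<in> unit_disk \<Longrightarrow> zderiv_quot f g z = 1 + z ^ n * \<psi> z"
proof -
  obtain F where F: "F holomorphic_on unit_disk"
    and f': "\<And>z. z \<in> unit_disk \<Longrightarrow> deriv f z = 1 + z ^ n1 * F z"
    using class_A_deriv_factor[OF f] by blast
  obtain G where G: "G holomorphic_on unit_disk"
    and gG: "\<And>z. z \<in> unit_disk \<Longrightarrow> g z = z + z ^ (n2 + 1) * G z"
    using class_A_factor[OF g] by blast
  have n: "n1 = n + (n1 - n)" "n2 = n + (n2 - n)"
    using assms by auto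
  \<comment> \<open>Off the origin this expression is g(z)/z; at the origin it equals 1 because n2 >
    0.\<close>
  have D: "1 + z ^ n2 * G z \<noteq> 0" if "z \<in> unit_disk" for z
  proof (cases "z = 0")
    case False
    have "g z = z * (1 + z ^ n2 * G z)"
      using gG[OF that] by (simp add: algebra_simps)
    then show ?thesis using nz[of z] that False by force
  qed (use \<open>n \<le> n2\<close> \<open>0 < n\<close> in \<open>simp add: power_0_left\<close>)
  define \<psi> where "\<psi> z = (z ^ (n1 - n) * F z - z ^ (n2 - n) * G z) / (1 + z ^ n2 * G z)" for z
  have "\<psi> holomorphic_on unit_disk"
    unfolding \<psi>_def by (intro holomorphic_intros F G D)
  moreover have "zderiv_quot f g z = 1 + z ^ n * \<psi> z" if z: "z \<in> unit_disk" for z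
  proof (cases "z = 0")
    case True
    then show ?thesis using assms by (simp add: zderiv_quot_def)
  next
    case False
    have "zderiv_quot f g z = z * (1 + z ^ n1 * F z) / (z * (1 + z ^ n2 * G z))"
      using False f'[OF z] gG[OF z] by (simp add: zderiv_quot_def algebra_simps)
    also have "\<dots> = (1 + z ^ n1 * F z) / (1 + z ^ n2 * G z)"
      using False by simp
    also have "\<dots> = 1 + (z ^ n1 * F z - z ^ n2 * G z) / (1 + z ^ n2 * G z)"
      using D[OF z] by (simp add: field_simps)
    also have "z ^ n1 * F z - z ^ n2 * G z = z ^ n * (z ^ (n1 - n) * F z - z ^ (n2 - n) * G z)"
      by (subst (1) n(1), subst (1) n(2), simp add: power_add algebra_simps)
    finally show ?thesis by (simp add: \<psi>_def)
  qed
  ultimately show ?thesis using that by blast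
qed

section \<open>Orders of vanishing at the origin\<close>

text \<open>Integration raises the order of a zero at the origin by one. Each induction step shows
  that the cofactor already found vanishes at 0, so that \<open>Schwarz3\<close> splits off one more
  factor z.\<close>

lemma power_factor_of_deriv:
  assumes F: "F holomorphic_on unit_disk" "F 0 = 0"
    and "\<theta> holomorphic_on unit_disk"
    and "\<And>z. z \<in> unit_disk \<Longrightarrow> deriv F z = z ^ m * \<theta> z"
  obtains \<phi> where "\<phi> holomorphic_on unit_disk"
    and "\<And>z. z \<in> unit_disk \<Longrightarrow> F z = z ^ Suc m * \<phi> z"
  using assms(3,4)
proof (induction m arbitrary: \<theta> thesis)
  case 0
  obtain h where "h holomorphic_on ball 0 1" "\<And>z. norm z < 1 \<Longrightarrow> F z = z * h z"
    using Schwarz3[OF F] by metis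
  then show ?case using 0(1)[of h] by simp
next
  case (Suc m)
  have z\<theta>: "(\<lambda>z. z * \<theta> z) holomorphic_on unit_disk"
    by (intro holomorphic_intros Suc.prems(2))
  have "deriv F z = z ^ m * (z * \<theta> z)" if "z \<in> unit_disk" for z
    using Suc.prems(3)[OF that] by (simp add: mult_ac)
  then obtain \<phi> where \<phi>: "\<phi> holomorphic_on unit_disk"
    and F\<phi>: "\<And>z. z \<in> unit_disk \<Longrightarrow> F z = z ^ Suc m * \<phi> z"
    using Suc.IH[OF _ z\<theta>] by blast
  \<comment> \<open>D is the difference of two expressions for F'/z^m: one from the factorisation
    just obtained, one from the hypothesis. They agree off the origin, hence at it by continuity,
    and there D is a nonzero multiple of \<open>\<phi> 0\<close>.\<close>
  define D where "D z = of_nat (Suc m) * \<phi> z + z * deriv \<phi> z - z * \<theta> z" for z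
  have D0: "D z = 0" if z: "z \<in> unit_disk" "z \<noteq> 0" for z
  proof -
    have "((\<lambda>z. z ^ Suc m * \<phi> z) has_field_derivative
            z ^ m * (of_nat (Suc m) * \<phi> z + z * deriv \<phi> z)) (at z)"
      by (rule derivative_eq_intros holomorphic_derivI[OF \<phi> open_ball z(1)] refl)+
         (simp add: algebra_simps)
    then have "(F has_field_derivative z ^ m * (of_nat (Suc m) * \<phi> z + z * deriv \<phi> z)) (at z)"
      by (rule has_field_derivative_transform_within_open[OF _ open_ball z(1)]) (use F\<phi> in auto)
    then have "z ^ m * (of_nat (Suc m) * \<phi> z + z * deriv \<phi> z) = z ^ m * (z * \<theta> z)"
      using Suc.prems(3)[OF z(1)] DERIV_imp_deriv by (fastforce simp: mult_ac)
    then show ?thesis using z(2) by (simp add: D_def)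
  qed
  have "D holomorphic_on unit_disk"
    unfolding D_def by (intro holomorphic_intros \<phi> Suc.prems(2) open_ball)
  then have "isCont D 0"
    using continuous_on_interior[of unit_disk D 0] by (simp add: holomorphic_on_imp_continuous_on)
  then have "(D \<longlongrightarrow> D 0) (at 0)" by (simp add: isCont_def)
  moreover have "(D \<longlongrightarrow> 0) (at 0)"
  proof (rule Lim_transform_eventually[OF tendsto_const])
    show "\<forall>\<^sub>F z in at 0. 0 = D z"
      unfolding eventually_at_topological using D0 by (intro exI[of _ unit_disk]) auto
  qed
  ultimately have "D 0 = 0"
    using tendsto_unique trivial_limit_at by blast
  then have "\<phi> 0 = 0" by (simp add: D_def del: of_nat_Suc)
  then obtain h where "h holomorphic_on ball 0 1" "\<And>z. norm z < 1 \<Longrightarrow> \<phi> z = z * h z"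
    using Schwarz3[OF \<phi>] by metis
  then show ?case using Suc.prems(1)[of h] F\<phi> by (simp add: mult_ac)
qed

lemma deriv_log_branch:
  assumes "log_branch h L" "z \<in> unit_disk"
  shows "(h has_field_derivative h z * deriv L z) (at z)"
proof -
  have L: "L holomorphic_on unit_disk" and e: "\<And>z. z \<in> unit_disk \<Longrightarrow> exp (L z) = h z"
    using assms by (auto simp: log_branch_def)
  have "((\<lambda>z. exp (L z)) has_field_derivative h z * deriv L z) (at z)"
    by (rule derivative_eq_intros holomorphic_derivI[OF L open_ball assms(2)] refl)+
       (use e[OF assms(2)] in simp)
  then show ?thesis
    by (rule has_field_derivative_transform_within_open[OF _ open_ball assms(2)]) (simp add: e)
qed

text \<open>Passing from h to its power h^c preserves the order of vanishing of h - 1: the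
  derivative of exp(c L) is c exp(c L) h'/h, which contains h' and hence z^(n-1), and integration
  restores the lost factor z.\<close>

lemma log_branch_power_factor:
  assumes L: "log_branch h L" and \<psi>: "\<psi> holomorphic_on unit_disk"
    and h: "\<And>z. z \<in> unit_disk \<Longrightarrow> h z = 1 + z ^ n * \<psi> z" and "0 < n"
  obtains \<phi> where "\<phi> holomorphic_on unit_disk"
    and "\<And>z. z \<in> unit_disk \<Longrightarrow> exp (of_real c * L z) - 1 = z ^ n * \<phi> z"
proof -
  obtain m where m: "n = Suc m" using \<open>0 < n\<close> by (cases n) auto
  have Lh: "L holomorphic_on unit_disk" and e: "\<And>z. z \<in> unit_disk \<Longrightarrow> exp (L z) = h z"
    and L0: "L 0 = 0"
    using L by (auto simp: log_branch_def)
  have hnz: "h z \<noteq> 0" if "z \<in> unit_disk" for z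
    using e[OF that] by (metis exp_not_eq_zero)
  \<comment> \<open>This is h'/h stripped of z^(n-1). The denominator h is written as
    \<open>exp (L z)\<close>, so that it is visibly free of zeros.\<close>
  define \<kappa> where "\<kappa> z = (of_nat n * \<psi> z + z * deriv \<psi> z) / exp (L z)" for z
  have dL: "deriv L z = z ^ m * \<kappa> z" if z: "z \<in> unit_disk" for z
  proof -
    have "((\<lambda>z. 1 + z ^ n * \<psi> z) has_field_derivative z ^ m * (of_nat n * \<psi> z + z * deriv \<psi> z)) (at z)"
      unfolding m
      by (rule derivative_eq_intros holomorphic_derivI[OF \<psi> open_ball z] refl)+
         (simp add: algebra_simps)
    then have "(h has_field_derivative z ^ m * (of_nat n * \<psi> z + z * deriv \<psi> z)) (at z)"
      by (rule has_field_derivative_transform_within_open[OF _ open_ball z]) (use h in auto)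
    then have "z ^ m * (of_nat n * \<psi> z + z * deriv \<psi> z) = h z * deriv L z"
      using deriv_log_branch[OF L z] DERIV_unique by blast
    then show ?thesis using hnz[OF z] e[OF z] by (simp add: \<kappa>_def field_simps)
  qed
  define W where "W z = exp (of_real c * L z) - 1" for z
  define \<theta> where "\<theta> z = exp (of_real c * L z) * of_real c * \<kappa> z" for z
  have W: "W holomorphic_on unit_disk"
    unfolding W_def by (intro holomorphic_intros Lh)
  have \<theta>: "\<theta> holomorphic_on unit_disk"
    unfolding \<theta>_def \<kappa>_def by (intro holomorphic_intros Lh \<psi> open_ball) auto
  have "deriv W z = z ^ m * \<theta> z" if z: "z \<in> unit_disk" for z
  proof (rule DERIV_imp_deriv)
    show "(W has_field_derivative z ^ m * \<theta> z) (at z)"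
      unfolding W_def
      by (rule derivative_eq_intros holomorphic_derivI[OF Lh open_ball z] refl)+
         (use dL[OF z] in \<open>simp add: \<theta>_def\<close>)
  qed
  then show ?thesis
    using power_factor_of_deriv[OF W _ \<theta>] L0 that unfolding W_def m by auto
qed

section \<open>Jack's lemma\<close>

text \<open>On a circle the real part of \<open>\<phi>(z) / \<phi>(z0)\<close> is maximal at \<open>z0\<close>; differentiating along
  \<open>z0 exp (s c)\<close> for \<open>c = \<i>\<close> and \<open>c = 1\<close> gives the imaginary and real part of the claim.\<close>

lemma log_deriv_at_max:
  assumes \<phi>: "\<phi> holomorphic_on unit_disk" and z0: "z0 \<in> unit_disk"
    and nz: "\<phi> z0 \<noteq> 0"
    and max: "\<And>z. norm z \<le> norm z0 \<Longrightarrow> norm (\<phi> z) \<le> norm (\<phi> z0)"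
  shows "Im (z0 * deriv \<phi> z0 / \<phi> z0) = 0" "0 \<le> Re (z0 * deriv \<phi> z0 / \<phi> z0)"
proof -
  define u where "u c s = Re (\<phi> (z0 * exp (of_real s * c)) / \<phi> z0)" for c and s :: real
  have du: "DERIV (u c) 0 :> Re (c * (z0 * deriv \<phi> z0 / \<phi> z0))" for c
  proof -
    \<comment> \<open>The base point is kept in the form \<open>of_real 0\<close> so that the
      complex derivative can be restricted to the real line below.\<close>
    have "(\<phi> has_field_derivative deriv \<phi> z0) (at (z0 * exp (of_real 0 * c)))"
      using holomorphic_derivI[OF \<phi> open_ball z0] by simp
    moreover have "((\<lambda>s. z0 * exp (s * c)) has_field_derivative z0 * c) (at (of_real 0))"
      by (auto intro!: derivative_eq_intros)
    ultimately have "((\<lambda>s. \<phi> (z0 * exp (s * c))) has_field_derivative deriv \<phi> z0 * (z0 * c))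
        (at (of_real 0))"
      using DERIV_chain2 by (metis of_real_0)
    then have "((\<lambda>s. \<phi> (z0 * exp (s * c)) / \<phi> z0) has_field_derivative
        deriv \<phi> z0 * (z0 * c) / \<phi> z0) (at (of_real 0))"
      by (rule DERIV_cdivide)
    from has_vector_derivative_real_field[OF this]
    have "(u c has_vector_derivative Re (deriv \<phi> z0 * (z0 * c) / \<phi> z0)) (at 0)"
      unfolding u_def by (rule bounded_linear.has_vector_derivative[OF bounded_linear_Re])
    then show ?thesis
      by (simp add: has_real_derivative_iff_has_vector_derivative mult_ac)
  qed
  have u0: "u c 0 = 1" for c
    using nz by (simp add: u_def)
  \<comment> \<open>The condition on s says that the curve stays in the closed disk of radius |z0|.
    It holds for all s if c = \<i>, giving a two-sided maximum and derivative 0, but only for s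
    \<le> 0 if c = 1, giving just a sign.\<close>
  have u1: "u c s \<le> 1" if "s * Re c \<le> 0" for c s
  proof -
    have "norm (z0 * exp (of_real s * c)) \<le> norm z0"
      using that by (simp add: norm_mult mult_left_le)
    then have "norm (\<phi> (z0 * exp (of_real s * c)) / \<phi> z0) \<le> 1"
      using max nz by (simp add: norm_divide)
    then show ?thesis
      unfolding u_def using complex_Re_le_cmod order_trans by blast
  qed
  have "Re (\<i> * (z0 * deriv \<phi> z0 / \<phi> z0)) = 0"
    by (rule DERIV_local_max[OF du zero_less_one]) (simp add: u0 u1)
  then show "Im (z0 * deriv \<phi> z0 / \<phi> z0) = 0"
    by (simp only: Re_i_times)
  show "0 \<le> Re (z0 * deriv \<phi> z0 / \<phi> z0)"
  proof (rule ccontr)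
    assume "\<not> ?thesis"
    then obtain d where "d > 0" "\<forall>h>0. h < d \<longrightarrow> u 1 0 < u 1 (0 - h)"
      using DERIV_neg_dec_left[OF du[of 1]] by auto
    then have "u 1 0 < u 1 (- (d / 2))"
      by (metis diff_0 field_sum_of_halves half_gt_zero less_add_same_cancel2)
    then show False
      using u0[of 1] u1[of "- (d / 2)" 1] \<open>d > 0\<close> by simp
  qed
qed

text \<open>The maximum modulus principle on a smaller closed disk. Jack's lemma needs it because
  |z^n| is constant only on circles: there a bound for w gives one for \<phi>, which must then be
  carried inside.\<close>

lemma norm_le_of_sphere:
  fixes \<phi> :: "complex \<Rightarrow> complex"
  assumes \<phi>: "\<phi> holomorphic_on unit_disk" and r: "0 < r" "r < 1"
    and B: "\<And>z. norm z = r \<Longrightarrow> norm (\<phi> z) \<le> B" and z: "norm z \<le> r"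
  shows "norm (\<phi> z) \<le> B"
proof (rule maximum_modulus_frontier[of \<phi> "cball 0 r"])
  have "\<phi> holomorphic_on cball 0 r"
    by (rule holomorphic_on_subset[OF \<phi>]) (use r in auto)
  then show "continuous_on (closure (cball 0 r)) \<phi>"
    by (simp add: holomorphic_on_imp_continuous_on)
  show "\<phi> holomorphic_on interior (cball 0 r)"
    by (rule holomorphic_on_subset[OF \<phi>]) (use r in auto)
  show "norm (\<phi> z) \<le> B" if "z \<in> frontier (cball 0 r)" for z
    using that r B by simp
qed (use z in auto)

text \<open>At the first point z0 where |w| reaches 1, the cofactor \<phi> = w/z^n attains its
  maximum modulus over |z| \<le> |z0|. Hence z0 \<phi>'(z0)/\<phi>(z0) is real and nonnegative, and
  the logarithmic derivative of z^n adds n to it, which gives k.\<close>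

lemma Jack_lemma:
  assumes w: "w holomorphic_on unit_disk" and \<phi>: "\<phi> holomorphic_on unit_disk"
    and w\<phi>: "\<And>z. z \<in> unit_disk \<Longrightarrow> w z = z ^ n * \<phi> z" and "0 < n"
    and z1: "z1 \<in> unit_disk" "1 \<le> norm (w z1)"
  obtains z0 k where "z0 \<in> unit_disk" "z0 \<noteq> 0" "norm (w z0) = 1" "real n \<le> k"
    "z0 * deriv w z0 = of_real k * w z0"
proof -
  \<comment> \<open>With \<ge> 1 in place of = 1, every point of modulus below the minimum satisfies
    |w| < 1 at once; |w(z0)| = 1 then follows by continuity.\<close>
  define S where "S = {z \<in> cball 0 (norm z1). 1 \<le> norm (w z)}"
  have sub: "cball 0 (norm z1) \<subseteq> unit_disk" using z1 by auto
  have "continuous_on (cball 0 (norm z1)) w"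
    using w sub holomorphic_on_imp_continuous_on holomorphic_on_subset by blast
  then have "closed S"
    unfolding S_def
    by (intro continuous_on_closed_Collect_le continuous_intros) auto
  then have "compact S"
    unfolding compact_eq_bounded_closed
    using bounded_subset[OF bounded_cball[of 0 "norm z1"], of S] \<open>closed S\<close>
    by (simp add: S_def subset_iff)
  moreover have "z1 \<in> S" using z1 by (simp add: S_def)
  ultimately obtain z0 where z0: "z0 \<in> S" "\<And>z. z \<in> S \<Longrightarrow> norm z0 \<le> norm z"
    using continuous_attains_inf[of S norm] continuous_on_norm_id by blast
  have z0d: "z0 \<in> unit_disk" and ge: "1 \<le> norm (w z0)"
    using z0 sub by (auto simp: S_def)
  have w0: "w 0 = 0" using w\<phi>[of 0] \<open>0 < n\<close> by simp
  then have z0nz: "z0 \<noteq> 0" using ge by auto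
  have lt: "norm (w z) < 1" if "norm z < norm z0" for z
  proof (rule ccontr)
    assume "\<not> ?thesis"
    then have "z \<in> S" using that z0(2)[OF \<open>z1 \<in> S\<close>] by (simp add: S_def)
    then show False using z0(2) that by force
  qed
  have le: "norm (w z) \<le> 1" if "norm z \<le> norm z0" for z
  proof (rule continuous_le_on_closure[of "ball 0 (norm z0)" "\<lambda>z. norm (w z)"])
    have "continuous_on (cball 0 (norm z0)) w"
      by (rule holomorphic_on_imp_continuous_on[OF holomorphic_on_subset[OF w]])
         (use z0d in auto)
    then show "continuous_on (closure (ball 0 (norm z0))) (\<lambda>z. norm (w z))"
      using z0nz by (auto intro: continuous_intros)
    show "z \<in> closure (ball 0 (norm z0))" using that z0nz by simp
  qed (use lt less_imp_le in force)
  have eq: "norm (w z0) = 1" using ge le[of z0] by simp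
  have \<phi>z0: "norm (\<phi> z0) = 1 / norm z0 ^ n"
    using w\<phi>[OF z0d] eq z0nz by (simp add: norm_mult norm_power field_simps)
  then have \<phi>nz: "\<phi> z0 \<noteq> 0" using z0nz by auto
  have "norm (\<phi> z) \<le> norm (\<phi> z0)" if "norm z \<le> norm z0" for z
  proof (rule norm_le_of_sphere[OF \<phi> _ _ _ that])
    fix z :: complex assume z: "norm z = norm z0"
    then have "norm z0 ^ n * norm (\<phi> z) \<le> 1"
      using le[of z] w\<phi>[of z] z0d by (simp add: norm_mult norm_power)
    then show "norm (\<phi> z) \<le> norm (\<phi> z0)"
      using z0nz by (simp add: \<phi>z0 field_simps)
  qed (use z0d z0nz in auto)
  note q = log_deriv_at_max[OF \<phi> z0d \<phi>nz this]
  define k where "k = real n + Re (z0 * deriv \<phi> z0 / \<phi> z0)"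
  have kq: "of_real k = of_nat n + z0 * deriv \<phi> z0 / \<phi> z0"
    using q(1) by (simp add: k_def complex_eq_iff)
  have "((\<lambda>z. z ^ n * \<phi> z) has_field_derivative of_nat n * z0 ^ (n - 1) * \<phi> z0 + z0 ^ n * deriv \<phi> z0) (at z0)"
    by (rule derivative_eq_intros holomorphic_derivI[OF \<phi> open_ball z0d] refl)+
       (simp add: algebra_simps)
  then have "(w has_field_derivative of_nat n * z0 ^ (n - 1) * \<phi> z0 + z0 ^ n * deriv \<phi> z0) (at z0)"
    by (rule has_field_derivative_transform_within_open[OF _ open_ball z0d]) (use w\<phi> in auto)
  then have "z0 * deriv w z0 = of_nat n * (z0 * z0 ^ (n - 1)) * \<phi> z0 + z0 ^ n * (z0 * deriv \<phi> z0)"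
    by (simp add: DERIV_imp_deriv algebra_simps)
  also have "z0 * z0 ^ (n - 1) = z0 ^ n"
    using \<open>0 < n\<close> by (simp flip: power_Suc)
  also have "of_nat n * z0 ^ n * \<phi> z0 + z0 ^ n * (z0 * deriv \<phi> z0) = of_real k * w z0"
    unfolding kq w\<phi>[OF z0d] using \<phi>nz by (simp add: field_simps)
  finally show ?thesis
    using that[OF z0d z0nz eq, of k] q(2) by (simp add: k_def)
qed

section \<open>The unit circle, real powers and logarithmic differentiation\<close>

text \<open>The map w/(1 + w) sends the unit circle without -1 into the line Re = 1/2, since |1 +
  w|^2 = 2(1 + Re w) there.\<close>

lemma Re_div_one_plus:
  assumes "norm w = 1" "1 + w \<noteq> 0"
  shows "Re (w / (1 + w)) = 1 / 2"
proof -
  have 1: "(Re w)\<^sup>2 + (Im w)\<^sup>2 = 1" using assms by (simp add: cmod_def)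
  have "(1 + Re w)\<^sup>2 + (Im w)\<^sup>2 = 2 + 2 * Re w"
    using 1 by (simp add: power2_eq_square algebra_simps)
  moreover have "(1 + Re w)\<^sup>2 + (Im w)\<^sup>2 \<noteq> 0"
    using assms(2) by (auto simp: complex_eq_iff sum_power2_eq_zero_iff)
  moreover have "Re w * (1 + Re w) + Im w * Im w = 1 + Re w"
    using 1 by (simp add: power2_eq_square algebra_simps)
  ultimately show ?thesis by (simp add: Re_divide field_simps)
qed

lemma real_power_strict_mono:
  assumes "0 < c" "0 \<le> a" "a < b"
  shows "real_power a c < real_power b c"
proof (cases "c \<in> \<nat>")
  case True
  \<comment> \<open>A zero exponent would make the power constant and destroy strictness.\<close>
  then have "0 < nat \<lfloor>c\<rfloor>"
    using assms(1) by (auto elim!: Nats_cases)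
  then show ?thesis
    using True assms by (simp add: real_power_def power_strict_mono)
qed (use assms in \<open>auto simp: real_power_def intro: powr_less_mono2\<close>)

lemma real_power_one [simp]: "real_power 1 c = 1"
  by (simp add: real_power_def)

lemma real_power_zero_right [simp]: "real_power x 0 = 1"
  by (simp add: real_power_def)

text \<open>Formally log h = log z + log f' - log g for h = z f'/g, differentiated and multiplied by
  z. The quotient rule for h, compared with h' = h L', avoids the three separate logarithms.\<close>

lemma zderiv_quot_log_deriv:
  assumes f: "f holomorphic_on unit_disk" and g: "g holomorphic_on unit_disk"
    and L: "log_branch (zderiv_quot f g) L"
    and z: "z \<in> unit_disk" "z \<noteq> 0" and gz: "g z \<noteq> 0" and fz: "deriv f z \<noteq> 0"
  shows "1 + z * deriv (deriv f) z / deriv f z = zderiv_quot g g z + z * deriv L z"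
proof -
  have f': "deriv f holomorphic_on unit_disk"
    by (intro holomorphic_intros f open_ball)
  have "((\<lambda>z. z * deriv f z / g z) has_field_derivative
     ((deriv f z + z * deriv (deriv f) z) * g z - z * deriv f z * deriv g z) / (g z * g z)) (at z)"
    by (rule derivative_eq_intros holomorphic_derivI[OF f' open_ball z(1)]
          holomorphic_derivI[OF g open_ball z(1)] refl gz)+ (simp add: algebra_simps)
  then have "(zderiv_quot f g has_field_derivative
     ((deriv f z + z * deriv (deriv f) z) * g z - z * deriv f z * deriv g z) / (g z * g z)) (at z)"
    \<comment> \<open>The origin is removed because \<open>zderiv_quot\<close> is given there by its
      limiting value and not by the formula.\<close>
    by (rule has_field_derivative_transform_within_open[where S = "unit_disk - {0}"])
       (use z in \<open>auto simp: zderiv_quot_def\<close>)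
  from DERIV_unique[OF this deriv_log_branch[OF L z(1)]]
  have "((deriv f z + z * deriv (deriv f) z) * g z - z * deriv f z * deriv g z) / (g z * g z)
      = z * deriv f z / g z * deriv L z"
    using z by (simp add: zderiv_quot_def)
  then have "(deriv f z + z * deriv (deriv f) z) * g z - z * deriv f z * deriv g z
      = z * deriv f z / g z * deriv L z * (g z * g z)"
    using gz by (simp add: divide_eq_eq)
  then show ?thesis
    using gz fz z by (simp add: zderiv_quot_def field_simps)
qed

section \<open>The bound |w| < 1 and strong close-to-convexity\<close>

theorem theorem2:
  fixes n1 n2 n :: nat and \<alpha> \<mu> \<beta> \<gamma> :: real and \<delta> :: complex
    and f g :: "complex \<Rightarrow> complex"
  assumes "n1 > 0" and "n2 > 0" and "n = min n1 n2"
    and "0 \<le> \<alpha>" and "\<alpha> < 1" and "0 < \<mu>" and "\<mu> \<le> 1"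
    and "f \<in> class_A n1" and "g \<in> class_A n2 \<inter> starlike_of_order \<alpha>"
    and "\<beta> \<ge> 0" and "\<gamma> \<ge> 0" and "\<beta> + \<gamma> > 0"
    and "Re \<delta> > - (\<mu> * real n / 2) - \<alpha>"
    and "\<forall>z\<in>unit_disk. deriv f z \<noteq> 0"
    and "\<gamma> \<notin> \<nat> \<longrightarrow>
          (\<forall>z\<in>unit_disk. Re (\<delta> + 1 + z * deriv (deriv f) z / deriv f z) \<ge> 0)"
    and "\<forall>z\<in>unit_disk.
          real_power (norm (branch_power (zderiv_quot f g) (1 / \<mu>) z - 1)) \<beta> *
          real_power (Re (\<delta> + 1 + z * deriv (deriv f) z / deriv f z)) \<gamma>
          \<le> real_power (Re \<delta> + \<alpha> + \<mu> * real n / 2) \<gamma>"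
  shows "(\<forall>z\<in>unit_disk. norm (branch_power (zderiv_quot f g) (1 / \<mu>) z - 1) < 1) \<and>
         f \<in> strongly_close_to_convex \<mu>"
proof -
  have fA: "f \<in> class_A n1" and gA: "g \<in> class_A n2" and gS: "g \<in> starlike_of_order \<alpha>"
    using assms by auto
  have f: "f holomorphic_on unit_disk" and g: "g holomorphic_on unit_disk"
    using fA gA by (auto simp: class_A_def)
  have gnz: "g z \<noteq> 0" if "z \<in> unit_disk - {0}" for z
    using gS that by (auto simp: starlike_of_order_def)
  have n: "n \<le> n1" "n \<le> n2" "0 < n" using assms by auto
  obtain \<psi> where \<psi>: "\<psi> holomorphic_on unit_disk"
    and h\<psi>: "\<And>z. z \<in> unit_disk \<Longrightarrow> zderiv_quot f g z = 1 + z ^ n * \<psi> z"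
    using zderiv_quot_factor[OF fA gA n gnz] by blast
  \<comment> \<open>Holomorphy across the removable singularity is read off from the
    factorisation.\<close>
  have "zderiv_quot f g holomorphic_on unit_disk"
    by (subst holomorphic_cong[OF refl h\<psi>]) (auto intro!: holomorphic_intros \<psi>)
  moreover have "zderiv_quot f g z \<noteq> 0" if "z \<in> unit_disk" for z
    using that gnz[of z] assms(14) by (auto simp: zderiv_quot_def)
  ultimately obtain L where L: "log_branch (zderiv_quot f g) L"
    using log_branch_exists by (metis zderiv_quot_def)
  have Lh: "L holomorphic_on unit_disk" using L by (simp add: log_branch_def)
  define c where "c = 1 / \<mu>"
  define w where "w z = exp (of_real c * L z) - 1" for z
  have bp: "branch_power (zderiv_quot f g) (1 / \<mu>) z = 1 + w z" if "z \<in> unit_disk" for z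
    using branch_power_eq[OF L that] by (simp add: w_def c_def)
  have w: "w holomorphic_on unit_disk"
    unfolding w_def by (intro holomorphic_intros Lh)
  obtain \<phi> where \<phi>: "\<phi> holomorphic_on unit_disk"
    and w\<phi>: "\<And>z. z \<in> unit_disk \<Longrightarrow> w z = z ^ n * \<phi> z"
    using log_branch_power_factor[OF L \<psi> h\<psi> n(3), where c = c] unfolding w_def by blast
  have hyp: "real_power (norm (w z)) \<beta> *
      real_power (Re (\<delta> + 1 + z * deriv (deriv f) z / deriv f z)) \<gamma>
      \<le> real_power (Re \<delta> + \<alpha> + \<mu> * real n / 2) \<gamma>" if "z \<in> unit_disk" for z
    using assms(16)[rule_format, OF that] unfolding bp[OF that] by simp
  have main: "norm (w z) < 1" if z: "z \<in> unit_disk" for z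
  proof (rule ccontr)
    assume "\<not> ?thesis"
    then have ge: "1 \<le> norm (w z)" by simp
    obtain z0 k where z0: "z0 \<in> unit_disk" "z0 \<noteq> 0" "norm (w z0) = 1" "real n \<le> k"
      "z0 * deriv w z0 = of_real k * w z0"
      by (rule Jack_lemma[OF w \<phi> w\<phi> n(3) z ge])
    show False
    proof (cases "\<gamma> = 0")
      case True
      have "norm (w y) \<le> norm (w z0)" if "y \<in> unit_disk" for y
      proof (rule ccontr)
        assume "\<not> ?thesis"
        \<comment> \<open>Here \<beta> > 0, because \<gamma> = 0 and \<beta> + \<gamma> > 0; the
          hypothesis therefore bounds |w| by 1 = |w(z0)|, an interior maximum.\<close>
        then have "real_power 1 \<beta> < real_power (norm (w y)) \<beta>"
          using True assms(12) z0(3) by (intro real_power_strict_mono) auto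
        then show False using hyp[OF that] True by simp
      qed
      then have "w constant_on unit_disk"
        using maximum_modulus_principle[OF w open_ball connected_ball open_ball order_refl z0(1)]
        by blast
      moreover have "w 0 = 0" using w\<phi>[of 0] n by simp
      ultimately show False
        using z0(1,3) by (metis centre_in_ball constant_on_def norm_zero zero_less_one zero_neq_one)
    next
      case False
      \<comment> \<open>The value -1 is never taken, as 1 + w is an exponential.\<close>
      have nz: "1 + w z0 \<noteq> 0" by (simp add: w_def)
      have "(w has_field_derivative (1 + w z0) * (of_real c * deriv L z0)) (at z0)"
        unfolding w_def
        by (rule derivative_eq_intros holomorphic_derivI[OF Lh open_ball z0(1)] refl)+ simp
      then have "z0 * ((1 + w z0) * (of_real c * deriv L z0)) = of_real k * w z0"
        using z0(5) DERIV_imp_deriv by fastforce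
      \<comment> \<open>The factor \<mu> is 1/c, from w' = c (1 + w) L'.\<close>
      then have "z0 * deriv L z0 = of_real (\<mu> * k) * (w z0 / (1 + w z0))"
        using nz assms(6) by (simp add: c_def field_simps)
      then have "Re (z0 * deriv L z0) = \<mu> * k / 2"
        using Re_div_one_plus[OF z0(3) nz]
        by (simp only: times_complex.sel Re_complex_of_real Im_complex_of_real)
      moreover have "Re (zderiv_quot g g z0) > \<alpha>"
        using gS z0(1) by (simp add: starlike_of_order_def)
      moreover have "\<mu> * real n \<le> \<mu> * k" using z0(4) assms(6) by simp
      moreover have "1 + z0 * deriv (deriv f) z0 / deriv f z0 = zderiv_quot g g z0 + z0 * deriv L z0"
        using zderiv_quot_log_deriv[OF f g L z0(1,2)] gnz z0 assms(14) by blast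
      ultimately have "Re (\<delta> + 1 + z0 * deriv (deriv f) z0 / deriv f z0)
          > Re \<delta> + \<alpha> + \<mu> * real n / 2"
        by (simp add: add.assoc)
      \<comment> \<open>The condition on Re \<delta> makes the smaller base positive, so the power
        \<gamma> > 0 keeps the strict inequality. The other factor of the hypothesis is 1 at
        z0.\<close>
      then have "real_power (Re \<delta> + \<alpha> + \<mu> * real n / 2) \<gamma>
          < real_power (Re (\<delta> + 1 + z0 * deriv (deriv f) z0 / deriv f z0)) \<gamma>"
        using False assms(11,13) by (intro real_power_strict_mono) auto
      then show False using hyp[OF z0(1)] z0(3) by simp
    qed
  qed
  have "f \<in> class_A 1" using class_A_mono[OF fA] assms(1) by simp
  \<comment> \<open>Since \<alpha> \<ge> 0, the given g itself serves as the starlike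
    witness.\<close>
  moreover have "g \<in> starlike_of_order 0"
    using gS assms(4) by (force simp: starlike_of_order_def)
  \<comment> \<open>The disk of radius 1 about 1 lies in the right half-plane.\<close>
  moreover have "Re (branch_power (zderiv_quot f g) (1 / \<mu>) z) > 0" if "z \<in> unit_disk" for z
    using main[OF that] bp[OF that] abs_Re_le_cmod[of "w z"] by simp
  ultimately have "f \<in> strongly_close_to_convex \<mu>"
    unfolding strongly_close_to_convex_def using assms(14) by blast
  then show ?thesis
    using main bp by simp
qed

end
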